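(* A tame homeomorphism $T:K\to K$ of a compact Hausdorff space has zero topological entropy.
   Context: The enveloping semigroup of $(K,T)$ is the closure of $\{T^n:n\in\mathbb{Z}\}$ in $K^K$ with the product topology. The homeomorphism $T$ (equivalently the $\mathbb{Z}$-system $(K,T)$) is tame if its enveloping semigroup is separable and Fréchet (i.e. Fréchet–Urysohn: every point in the closure of a subset is the limit of a sequence from that subset). Topological entropy is the usual one, defined via finite open covers. *)

theory Defs
  imports "HOL-Analysis.Analysis"
begin

section \<open>Tame homeomorphisms\<close>

definition int_iterate :: "('a \<Rightarrow> 'a) \<Rightarrow> int \<Rightarrow> 'a \<Rightarrow> 'a" where
  "int_iterate T n = (if 0 \<le> n then T ^^ nat n else inv T ^^ nat (- n))"

text \<open>The type \<^typ>\<open>'a \<Rightarrow> 'a\<close> carries the product topology (pointwise convergence), by the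
  topological-space instance of the function type, so \<^const>\<open>closure\<close> is taken there.\<close>

definition enveloping_semigroup :: "('a::topological_space \<Rightarrow> 'a) \<Rightarrow> ('a \<Rightarrow> 'a) set" where
  "enveloping_semigroup T = closure (range (int_iterate T))"

definition frechet_urysohn_space :: "'a topology \<Rightarrow> bool" where
  "frechet_urysohn_space X \<longleftrightarrow>
     (\<forall>A p. A \<subseteq> topspace X \<and> p \<in> X closure_of A \<longrightarrow>
        (\<exists>x :: nat \<Rightarrow> 'a. range x \<subseteq> A \<and> limitin X x p sequentially))"

definition tame :: "('a::topological_space \<Rightarrow> 'a) \<Rightarrow> bool" where
  "tame T \<longleftrightarrow>
     separable_space (top_of_set (enveloping_semigroup T)) \<and>
     frechet_urysohn_space (top_of_set (enveloping_semigroup T))"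


section \<open>Topological entropy\<close>

definition finite_open_cover :: "'a::topological_space set set \<Rightarrow> bool" where
  "finite_open_cover \<U> \<longleftrightarrow> finite \<U> \<and> (\<forall>A\<in>\<U>. open A) \<and> \<Union>\<U> = UNIV"

definition min_subcover_card :: "'a set set \<Rightarrow> nat" where
  "min_subcover_card \<U> = (LEAST k. \<exists>\<V>\<subseteq>\<U>. finite \<V> \<and> \<Union>\<V> = UNIV \<and> card \<V> = k)"

definition cover_join :: "'a set set \<Rightarrow> 'a set set \<Rightarrow> 'a set set" where
  "cover_join \<U> \<V> = {A \<inter> B | A B. A \<in> \<U> \<and> B \<in> \<V>}"

text \<open>The join of the covers \<open>T\<^sup>-\<^sup>i \<U>\<close> for \<open>0 \<le> i < n\<close>; the empty join is the trivial cover.\<close>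

primrec iterated_join :: "('a \<Rightarrow> 'a) \<Rightarrow> 'a set set \<Rightarrow> nat \<Rightarrow> 'a set set" where
  "iterated_join T \<U> 0 = {UNIV}"
| "iterated_join T \<U> (Suc n) =
     cover_join (iterated_join T \<U> n) ((\<lambda>A. (T ^^ n) -` A) ` \<U>)"

text \<open>For a finite open cover and a continuous map the limit exists by Fekete's lemma: the
  logarithms of the minimal cardinalities form a subadditive sequence of nonnegative numbers.
  The term for \<open>n = 0\<close> is irrelevant.\<close>

definition cover_entropy :: "('a \<Rightarrow> 'a) \<Rightarrow> 'a set set \<Rightarrow> real" where
  "cover_entropy T \<U> =
     lim (\<lambda>n. ln (real (min_subcover_card (iterated_join T \<U> n))) / real n)"

definition topological_entropy :: "('a::topological_space \<Rightarrow> 'a) \<Rightarrow> ereal" where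
  "topological_entropy T = (SUP \<U>\<in>{\<U>. finite_open_cover \<U>}. ereal (cover_entropy T \<U>))"

end

theory Submission
  imports Defs
begin

text \<open>
  The proof is a dichotomy: exponential growth of the joins of some cover produces an infinite
  independent set of times, and an infinite independent set of times contradicts tameness.

  Call a set \<open>I\<close> of times independent for disjoint closed sets \<open>F\<close>, \<open>G\<close> if every
  \<open>0\<close>-\<open>1\<close> pattern on \<open>I\<close> is realised by an orbit, that is, for all \<open>\<sigma> \<subseteq> I\<close> some point
  visits \<open>F\<close> at the times in \<open>\<sigma>\<close> and \<open>G\<close> at the times in \<open>I - \<sigma>\<close>. If \<open>T\<close> is tame, the
  Frechet property together with compactness of the enveloping semigroup gives infinitely many
  times \<open>i\<^sub>n \<in> I\<close> along which the iterates converge pointwise, to some \<open>p\<close>. A point realising a pattern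
  that oscillates along \<open>i\<^sub>n\<close> then has \<open>p x \<in> F \<inter> G\<close>, which is impossible
  (\<open>tame_not_shatters_infinite\<close>).

  Now let \<open>\<U>\<close> be an open cover and refine it by a finite closed cover \<open>\<F>\<close>, each \<open>F \<in> \<F>\<close> lying in
  some \<open>u F \<in> \<U>\<close>. A coordinate is a pair of a time \<open>i < n\<close> and some \<open>F \<in> \<F>\<close>; it tells two points apart
  if at time \<open>i\<close> one of them is in \<open>F\<close> and the other one is outside \<open>u F\<close>. Given a maximal set \<open>V\<close> of
  points that are pairwise told apart by more than \<open>\<epsilon> n\<close> coordinates, every orbit segment of length \<open>n\<close>
  is followed, up to \<open>\<epsilon> n\<close> errors, by one starting in \<open>V\<close>. Guessing the errors costs a factor \<open>exp (c n / 2)\<close> if \<open>\<epsilon>\<close> is small, so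
  \<open>V\<close> has more than \<open>exp (c n / 2)\<close> points whenever the \<open>n\<close>-th join needs more than
  \<open>exp (c n)\<close> members. As points of \<open>V\<close> are told apart
  by a positive proportion of the coordinates, every subset of at least two points is split by some coordinate into two
  parts of proportional size, and a Sauer-Shelah induction over such splittings
  (\<open>card_shattered_ge\<close>) yields at least \<open>card V powr p\<close> shattered sets of coordinates, with \<open>p > 0\<close>
  independent of \<open>n\<close>. There are too few sparse sets for that, so a set of positive density is
  shattered (\<open>exponential_growth_imp_dense_shattering\<close>).

  The independent sets form a family closed under subsets and under translation to the left. If such a family has members
  of uniformly positive density in arbitrarily long intervals, it contains all finite subsets of
  one infinite set (\<open>infinite_set_of_dense_family\<close>), and compactness of the phase space makes that
  infinite set independent. Hence for tame \<open>T\<close> all joins grow subexponentially.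
\<close>

section \<open>Shattering by pairs of disjoint sets\<close>

text \<open>The two sets of a pair need not cover the space: a point outside \<open>P z \<union> Q z\<close> has no value
  at the coordinate \<open>z\<close>, so points behave as partial \<open>0\<close>-\<open>1\<close> words.\<close>

definition shatters :: "('z \<Rightarrow> 'x set) \<Rightarrow> ('z \<Rightarrow> 'x set) \<Rightarrow> 'x set \<Rightarrow> 'z set \<Rightarrow> bool" where
  "shatters P Q V S \<longleftrightarrow> (\<forall>\<sigma>\<subseteq>S. \<exists>x\<in>V. (\<forall>z\<in>\<sigma>. x \<in> P z) \<and> (\<forall>z\<in>S - \<sigma>. x \<in> Q z))"

lemma shattersE:
  assumes "shatters P Q V S" "\<sigma> \<subseteq> S"
  obtains x where "x \<in> V" "\<And>z. z \<in> \<sigma> \<Longrightarrow> x \<in> P z" "\<And>z. z \<in> S - \<sigma> \<Longrightarrow> x \<in> Q z"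
proof -
  from assms have "\<exists>x\<in>V. (\<forall>z\<in>\<sigma>. x \<in> P z) \<and> (\<forall>z\<in>S - \<sigma>. x \<in> Q z)"
    by (simp add: shatters_def)
  then show thesis using that by auto
qed

lemma shatters_empty: "V \<noteq> {} \<Longrightarrow> shatters P Q V {}"
  by (auto simp: shatters_def)

lemma shatters_mono:
  assumes "shatters P Q V S" "V \<subseteq> W" "S' \<subseteq> S"
  shows "shatters P Q W S'"
  unfolding shatters_def
proof (intro allI impI)
  fix \<sigma> assume "\<sigma> \<subseteq> S'"
  then obtain x where "x \<in> V" "\<And>z. z \<in> \<sigma> \<Longrightarrow> x \<in> P z" "\<And>z. z \<in> S - \<sigma> \<Longrightarrow> x \<in> Q z"
    using shattersE[OF assms(1), of \<sigma>] assms(3) by blast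
  then show "\<exists>x\<in>W. (\<forall>z\<in>\<sigma>. x \<in> P z) \<and> (\<forall>z\<in>S' - \<sigma>. x \<in> Q z)"
    using assms by blast
qed

lemma shatters_insert:
  assumes P: "shatters P Q (V \<inter> P z) S" and Q: "shatters P Q (V \<inter> Q z) S"
  shows "shatters P Q V (insert z S)"
  unfolding shatters_def
proof (intro allI impI)
  fix \<sigma> assume \<sigma>: "\<sigma> \<subseteq> insert z S"
  have "\<sigma> - {z} \<subseteq> S" using \<sigma> by blast
  show "\<exists>x\<in>V. (\<forall>y\<in>\<sigma>. x \<in> P y) \<and> (\<forall>y\<in>insert z S - \<sigma>. x \<in> Q y)"
  proof (cases "z \<in> \<sigma>")
    case True
    from shattersE[OF P \<open>\<sigma> - {z} \<subseteq> S\<close>] obtain x where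
      "x \<in> V \<inter> P z" "\<And>y. y \<in> \<sigma> - {z} \<Longrightarrow> x \<in> P y" "\<And>y. y \<in> S - (\<sigma> - {z}) \<Longrightarrow> x \<in> Q y"
      by blast
    with True show ?thesis by blast
  next
    case False
    from shattersE[OF Q \<open>\<sigma> - {z} \<subseteq> S\<close>] obtain x where
      "x \<in> V \<inter> Q z" "\<And>y. y \<in> \<sigma> - {z} \<Longrightarrow> x \<in> P y" "\<And>y. y \<in> S - (\<sigma> - {z}) \<Longrightarrow> x \<in> Q y"
      by blast
    with False show ?thesis by blast
  qed
qed

text \<open>On a set that lies on one side of the pair at \<open>z\<close>, the other value at \<open>z\<close> is never taken.\<close>

lemma not_shatters_one_sided:
  assumes "P z \<inter> Q z = {}" "z \<in> S"
  shows "\<not> shatters P Q (V \<inter> P z) S" and "\<not> shatters P Q (V \<inter> Q z) S"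
proof -
  show "\<not> shatters P Q (V \<inter> P z) S"
  proof
    assume "shatters P Q (V \<inter> P z) S"
    from shattersE[OF this, of "{}"] obtain x where "x \<in> V \<inter> P z" "\<And>y. y \<in> S \<Longrightarrow> x \<in> Q y"
      by auto
    then show False using assms by blast
  qed
  show "\<not> shatters P Q (V \<inter> Q z) S"
  proof
    assume "shatters P Q (V \<inter> Q z) S"
    from shattersE[OF this, of "S"] obtain x where "x \<in> V \<inter> Q z" "\<And>y. y \<in> S \<Longrightarrow> x \<in> P y"
      by auto
    then show False using assms by blast
  qed
qed

text \<open>A set shattered by only one half is shattered by the whole. A set \<open>S\<close> shattered by both halves
  is counted twice on the left, and pays for this with the additional set \<open>insert z S\<close>,
  which neither half shatters.\<close>

lemma card_shattered_split:
  assumes "finite Z" "z \<in> Z" "P z \<inter> Q z = {}"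
  shows "card {S. S \<subseteq> Z \<and> shatters P Q (V \<inter> P z) S} + card {S. S \<subseteq> Z \<and> shatters P Q (V \<inter> Q z) S}
       \<le> card {S. S \<subseteq> Z \<and> shatters P Q V S}"
proof -
  define A where "A = {S. S \<subseteq> Z \<and> shatters P Q (V \<inter> P z) S}"
  define B where "B = {S. S \<subseteq> Z \<and> shatters P Q (V \<inter> Q z) S}"
  have fin: "finite A" "finite B" "finite {S. S \<subseteq> Z \<and> shatters P Q V S}"
    using assms(1) by (auto simp: A_def B_def)
  have notin: "z \<notin> S" if "S \<in> A \<union> B" for S
    using that not_shatters_one_sided[of P z Q S V] assms(3) by (auto simp: A_def B_def)
  have inj: "inj_on (insert z) (A \<inter> B)"
    by (rule inj_onI) (metis IntD1 UnI1 insert_ident notin)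
  have "card A + card B = card (A \<union> B) + card (A \<inter> B)"
    using card_Un_Int fin by blast
  also have "\<dots> = card (A \<union> B) + card (insert z ` (A \<inter> B))"
    by (simp add: card_image inj)
  also have "\<dots> = card ((A \<union> B) \<union> insert z ` (A \<inter> B))"
    by (rule card_Un_disjoint[symmetric]) (use fin notin in auto)
  also have "\<dots> \<le> card {S. S \<subseteq> Z \<and> shatters P Q V S}"
  proof (rule card_mono[OF fin(3)], safe)
    fix S y assume S: "S \<in> A" "S \<in> B"
    show "shatters P Q V (insert z S)"
      using S unfolding A_def B_def by (auto intro: shatters_insert)
    assume "y \<in> S" then show "y \<in> Z" using S by (auto simp: A_def)
  qed (use assms(2) in \<open>auto simp: A_def B_def intro: shatters_mono\<close>)
  finally show ?thesis by (simp add: A_def B_def)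
qed

text \<open>For total \<open>0\<close>-\<open>1\<close> words, splitting a set at a coordinate loses no point, and this induction gives
  the Sauer-Shelah bound with exponent \<open>1\<close>. Here the points without a value at \<open>z\<close> are lost
  in the splitting; two parts of proportion \<open>\<eta>\<close> compensate the loss after
  passing to the power \<open>p\<close> with \<open>2 * \<eta> powr p = 1\<close>.\<close>

lemma card_shattered_ge:
  fixes \<eta> p :: real
  assumes Z: "finite Z" "\<And>z. z \<in> Z \<Longrightarrow> P z \<inter> Q z = {}"
    and p: "0 \<le> p" "0 < \<eta>" "1 \<le> 2 * \<eta> powr p"
    and V: "finite V" "V \<noteq> {}"
    and split: "\<And>W. W \<subseteq> V \<Longrightarrow> 2 \<le> card W \<Longrightarrow>
      \<exists>z\<in>Z. \<eta> * card W \<le> card (W \<inter> P z) \<and> \<eta> * card W \<le> card (W \<inter> Q z)"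
  shows "card V powr p \<le> card {S. S \<subseteq> Z \<and> shatters P Q V S}"
  using V split
proof (induction "card V" arbitrary: V rule: less_induct)
  case less
  have "card V \<noteq> 0" using less.prems by simp
  show ?case
  proof (cases "2 \<le> card V")
    case False
    with \<open>card V \<noteq> 0\<close> have 1: "card V = 1" by linarith
    have "{} \<in> {S. S \<subseteq> Z \<and> shatters P Q V S}"
      using shatters_empty[OF less.prems(2)] by simp
    then have "0 < card {S. S \<subseteq> Z \<and> shatters P Q V S}"
      using Z(1) by (subst card_gt_0_iff) auto
    then show ?thesis by (simp add: 1)
  next
    case True
    then obtain z where z: "z \<in> Z"
      and bP: "\<eta> * card V \<le> card (V \<inter> P z)" and bQ: "\<eta> * card V \<le> card (V \<inter> Q z)"
      using less.prems(3)[of V] by blast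
    have pos: "0 < \<eta> * card V" using p(2) True by simp
    have ne: "V \<inter> P z \<noteq> {}" "V \<inter> Q z \<noteq> {}" using bP bQ pos by auto
    have psub: "V \<inter> P z \<subset> V" "V \<inter> Q z \<subset> V" using ne Z(2)[OF z] by auto
    have less1: "card (V \<inter> P z) < card V" "card (V \<inter> Q z) < card V"
      using psub less.prems(1) by (auto intro: psubset_card_mono)
    have IH: "card (V \<inter> P z) powr p \<le> card {S. S \<subseteq> Z \<and> shatters P Q (V \<inter> P z) S}"
             "card (V \<inter> Q z) powr p \<le> card {S. S \<subseteq> Z \<and> shatters P Q (V \<inter> Q z) S}"
      by (rule less.hyps; use less1 ne less.prems in blast)+
    have "card V powr p \<le> 2 * \<eta> powr p * card V powr p"
      using p(3) mult_right_mono[of 1 "2 * \<eta> powr p" "card V powr p"] by simp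
    also have "\<dots> = (\<eta> * card V) powr p + (\<eta> * card V) powr p"
      using p(2) by (simp add: powr_mult)
    also have "\<dots> \<le> card (V \<inter> P z) powr p + card (V \<inter> Q z) powr p"
      by (intro add_mono powr_mono2) (use p(1) pos bP bQ in auto)
    also have "\<dots> \<le> card {S. S \<subseteq> Z \<and> shatters P Q V S}"
      using IH card_shattered_split[of Z z P Q V, OF Z(1) z Z(2)[OF z]] by linarith
    finally show ?thesis .
  qed
qed

section \<open>Separated sets of points\<close>

definition separators :: "('z \<Rightarrow> 'x set) \<Rightarrow> ('z \<Rightarrow> 'x set) \<Rightarrow> 'z set \<Rightarrow> 'x \<Rightarrow> 'x \<Rightarrow> 'z set" where
  "separators P Q Z x y = {z\<in>Z. x \<in> P z \<and> y \<in> Q z \<or> x \<in> Q z \<and> y \<in> P z}"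

text \<open>Double counting of pairs of distinct points and of the coordinates separating them: on average over
  \<open>z \<in> Z\<close>, a proportion of at least \<open>k / card Z\<close> of the pairs is separated at \<open>z\<close>. Few pairs would be
  separated at a coordinate with a small side.\<close>

lemma separated_balanced_coordinate:
  fixes k :: real
  assumes "finite Z" "finite W" "2 \<le> card W" "0 < k"
    and sep: "pairwise (\<lambda>x y. k \<le> card (separators P Q Z x y)) W"
  shows "\<exists>z\<in>Z. k / (4 * card Z) * card W \<le> card (W \<inter> P z) \<and> k / (4 * card Z) * card W \<le> card (W \<inter> Q z)"
proof (rule ccontr)
  define N where "N = real (card W)"
  define \<kappa> where "\<kappa> = k / (4 * card Z)"
  define b :: "'a \<Rightarrow> 'b \<times> 'b \<Rightarrow> real"
    where "b z xy = of_bool (z \<in> separators P Q Z (fst xy) (snd xy))" for z xy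
  define D where "D = W \<times> W - Id_on W"
  assume contra: "\<not> ?thesis"
  have N: "2 \<le> N" using assms by (simp add: N_def)
  have fin: "finite D" using assms by (simp add: D_def)
  have "Id_on W = (\<lambda>x. (x, x)) ` W" by (auto simp: Id_on_def)
  then have "card (Id_on W) = card W" by (simp add: card_image inj_on_def)
  then have "card D = card W * card W - card W"
    unfolding D_def using assms(2)
    by (subst card_Diff_subset) (auto intro: finite_subset[of _ "W \<times> W"] simp: card_cartesian_product)
  then have cardD: "real (card D) = N * (N - 1)"
    using assms(3) by (simp add: N_def algebra_simps of_nat_diff)
  have lower: "k * (N * (N - 1)) \<le> (\<Sum>xy\<in>D. \<Sum>z\<in>Z. b z xy)"
  proof -
    have "k * card D = (\<Sum>xy\<in>D. k)" by simp
    also have "\<dots> \<le> (\<Sum>xy\<in>D. \<Sum>z\<in>Z. b z xy)"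
    proof (rule sum_mono, clarify)
      fix x y assume "(x, y) \<in> D"
      then have "k \<le> card (separators P Q Z x y)" using sep by (auto simp: D_def pairwise_def)
      also have "separators P Q Z x y = Z \<inter> {z. z \<in> separators P Q Z x y}"
        by (auto simp: separators_def)
      then have "card (separators P Q Z x y) = (\<Sum>z\<in>Z. b z (x, y))"
        using assms(1) by (simp add: b_def sum.If_cases of_bool_def)
      finally show "k \<le> (\<Sum>z\<in>Z. b z (x, y))" .
    qed
    finally show ?thesis by (simp add: cardD)
  qed
  have "0 < k * (N * (N - 1))" using N assms(4) by simp
  then have "Z \<noteq> {}" using lower by auto
  \<comment> \<open>By the contrary assumption, one side at \<open>z\<close> has fewer than \<open>\<kappa> * N\<close> points, so \<open>z\<close> separates
    few pairs.\<close>
  have upper: "(\<Sum>xy\<in>D. b z xy) < 2 * \<kappa> * N\<^sup>2" if z: "z \<in> Z" for z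
  proof -
    define p where "p = real (card (W \<inter> P z))"
    define q where "q = real (card (W \<inter> Q z))"
    have pq: "0 \<le> p" "p \<le> N" "0 \<le> q" "q \<le> N"
      unfolding p_def q_def N_def using assms(2) by (auto intro: card_mono)
    have "p < \<kappa> * N \<or> q < \<kappa> * N"
      using contra z by (auto simp: p_def q_def \<kappa>_def N_def not_le)
    then have pqN: "p * q < \<kappa> * N * N"
    proof
      assume "p < \<kappa> * N"
      moreover have "p * q \<le> p * N" using pq by (intro mult_left_mono) auto
      moreover have "p * N < \<kappa> * N * N" using calculation N by (intro mult_strict_right_mono) auto
      ultimately show ?thesis by linarith
    next
      assume "q < \<kappa> * N"
      moreover have "p * q \<le> N * q" using pq by (intro mult_right_mono) auto
      moreover have "q * N < \<kappa> * N * N" using calculation N by (intro mult_strict_right_mono) auto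
      ultimately show ?thesis by (simp add: mult.commute)
    qed
    let ?R = "(W \<inter> P z) \<times> (W \<inter> Q z) \<union> (W \<inter> Q z) \<times> (W \<inter> P z)"
    have "(\<Sum>xy\<in>D. b z xy) = card (D \<inter> {xy. z \<in> separators P Q Z (fst xy) (snd xy)})"
      using fin by (simp add: b_def sum.If_cases of_bool_def)
    also have "card (D \<inter> {xy. z \<in> separators P Q Z (fst xy) (snd xy)}) \<le> card ?R"
      using assms(2) by (intro card_mono) (auto simp: D_def separators_def)
    also have "\<dots> \<le> card ((W \<inter> P z) \<times> (W \<inter> Q z)) + card ((W \<inter> Q z) \<times> (W \<inter> P z))"
      by (rule card_Un_le)
    also have "real \<dots> = 2 * (p * q)" by (simp add: p_def q_def card_cartesian_product)
    finally show ?thesis using pqN by (simp add: power2_eq_square mult.assoc)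
  qed
  have "k * (N * (N - 1)) \<le> (\<Sum>z\<in>Z. \<Sum>xy\<in>D. b z xy)"
    using lower by (subst sum.swap)
  also have "\<dots> < (\<Sum>z\<in>Z. 2 * \<kappa> * N\<^sup>2)"
    by (rule sum_strict_mono) (use upper assms(1) \<open>Z \<noteq> {}\<close> in auto)
  also have "\<dots> = k * (N * (N / 2))"
    using \<open>Z \<noteq> {}\<close> assms(1) by (simp add: \<kappa>_def power2_eq_square)
  finally have "N - 1 < N / 2" using N assms(4) by simp
  then show False using N by simp
qed

section \<open>Counting sparse sets\<close>

text \<open>Weighting a set \<open>S\<close> by \<open>t ^ card S\<close> for a fixed small \<open>t\<close> gives all subsets of \<open>Z\<close> the total
  weight \<open>(1 + t) ^ card Z \<le> exp (t * card Z)\<close>, while a set of at most \<open>\<epsilon> * card Z\<close> elements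
  weighs at least \<open>t powr (\<epsilon> * card Z)\<close>. The factor \<open>m powr (\<epsilon> * card Z)\<close> bounds the number of
  labellings of a sparse set by \<open>m\<close> labels.\<close>

lemma few_small_subsets:
  fixes m c :: real
  assumes "1 \<le> m" "0 < c"
  obtains \<epsilon> :: real where "0 < \<epsilon>" "\<epsilon> \<le> 1"
    "\<And>Z :: 'z set. finite Z \<Longrightarrow>
       card {S. S \<subseteq> Z \<and> card S \<le> \<epsilon> * card Z} * m powr (\<epsilon> * card Z) \<le> exp (c * card Z)"
proof
  define t where "t = min 1 (c / 2)"
  \<comment> \<open>Both contributions \<open>t\<close> and \<open>\<epsilon> * ln (m / t)\<close> to the growth rate are at most \<open>c / 2\<close>;
    the summand \<open>1\<close> only keeps the denominator positive.\<close>
  define \<epsilon> where "\<epsilon> = min 1 ((c / 2) / (ln (m / t) + 1))"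
  have t: "0 < t" "t \<le> 1" "t \<le> c / 2" using assms by (auto simp: t_def)
  have mt: "1 \<le> m / t" using t assms by simp
  then have L: "0 \<le> ln (m / t)" by simp
  show \<epsilon>: "0 < \<epsilon>" "\<epsilon> \<le> 1" using assms L by (auto simp: \<epsilon>_def)
  have "\<epsilon> * ln (m / t) \<le> (c / 2) / (ln (m / t) + 1) * (ln (m / t) + 1)"
    using L assms by (intro mult_mono) (auto simp: \<epsilon>_def)
  also have "\<dots> = c / 2" using L by (intro nonzero_eq_divide_eq[THEN iffD1]) auto
  finally have \<epsilon>L: "\<epsilon> * ln (m / t) \<le> c / 2" .
  fix Z :: "'z set" assume Z: "finite Z"
  define A where "A = {S. S \<subseteq> Z \<and> card S \<le> \<epsilon> * card Z}"
  define n where "n = real (card Z)"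
  have n: "0 \<le> n" by (simp add: n_def)
  have "card A * t powr (\<epsilon> * n) = (\<Sum>S\<in>A. t powr (\<epsilon> * n))" by simp
  also have "\<dots> \<le> (\<Sum>S\<in>A. t ^ card S)"
  proof (rule sum_mono)
    fix S assume "S \<in> A"
    then have "t powr (\<epsilon> * n) \<le> t powr card S"
      using t by (intro powr_mono') (auto simp: A_def n_def)
    then show "t powr (\<epsilon> * n) \<le> t ^ card S" using t by (simp add: powr_realpow)
  qed
  also have "\<dots> \<le> (\<Sum>S\<in>Pow Z. t ^ card S)"
    by (rule sum_mono2) (use Z t in \<open>auto simp: A_def\<close>)
  also have "\<dots> = (t + 1) ^ card Z"
    using prod_add[OF Z, of "\<lambda>_. t" "\<lambda>_. 1"] by simp
  also have "\<dots> \<le> exp t ^ card Z"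
    using t by (intro power_mono) (auto simp: add.commute exp_ge_add_one_self)
  also have "\<dots> = exp (t * n)" by (simp add: n_def exp_of_nat2_mult)
  finally have 1: "card A * t powr (\<epsilon> * n) \<le> exp (t * n)" .
  have "card A * m powr (\<epsilon> * n) = (card A * t powr (\<epsilon> * n)) * (m / t) powr (\<epsilon> * n)"
    using t assms by (simp add: powr_divide)
  also have "\<dots> \<le> exp (t * n) * (m / t) powr (\<epsilon> * n)"
    by (intro mult_right_mono 1) simp
  also have "\<dots> = exp ((t + \<epsilon> * ln (m / t)) * n)"
    using t assms by (simp add: powr_def exp_add[symmetric] algebra_simps)
  also have "\<dots> \<le> exp (c * n)"
    using \<epsilon>L t(3) n by (simp add: mult_right_mono)
  finally show "card {S. S \<subseteq> Z \<and> card S \<le> \<epsilon> * card Z} * m powr (\<epsilon> * card Z) \<le> exp (c * card Z)"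
    by (simp add: A_def n_def)
qed

section \<open>From dense finite sets to an infinite set\<close>

text \<open>The starting point \<open>t\<close> minimises the excess of the number of elements of \<open>S\<close> below \<open>t\<close>
  over \<open>\<delta> / 2 * t\<close>. By minimality, every interval starting at \<open>t\<close> has density at least
  \<open>\<delta> / 2\<close>. At \<open>t\<close> the excess is at most \<open>0\<close> whereas at \<open>n\<close> it is at least \<open>\<delta> / 2 * n\<close>, so
  \<open>t\<close> leaves room for \<open>\<delta> / 2 * n\<close> further steps.\<close>

lemma dense_set_leader:
  fixes S :: "nat set" and \<delta> :: real
  assumes \<delta>: "0 < \<delta>" and S: "S \<subseteq> {..<n}" "\<delta> * n \<le> card S"
  obtains t where "\<And>k. k \<le> \<delta> / 2 * n \<Longrightarrow> \<delta> / 2 * k \<le> card ({i. i + t \<in> S} \<inter> {..<k})"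
proof -
  define a where "a t = real (card (S \<inter> {..<t}))" for t
  define f where "f t = a t - \<delta> / 2 * t" for t :: nat
  obtain t where t: "t \<le> n" and min: "\<And>s. s \<le> n \<Longrightarrow> f t \<le> f s"
    using ex_is_arg_min_if_finite[of "{..n}" f] by (auto simp: is_arg_min_linorder)
  have diff: "a (t + k) = a t + card ({i. i + t \<in> S} \<inter> {..<k})" for k
  proof -
    have eq: "S \<inter> {..<t + k} = (S \<inter> {..<t}) \<union> (\<lambda>i. i + t) ` ({i. i + t \<in> S} \<inter> {..<k})"
    proof (intro equalityI subsetI)
      fix x assume x: "x \<in> S \<inter> {..<t + k}"
      show "x \<in> (S \<inter> {..<t}) \<union> (\<lambda>i. i + t) ` ({i. i + t \<in> S} \<inter> {..<k})"
      proof (cases "x < t")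
        case False
        then have "x = (x - t) + t" by simp
        then show ?thesis using x False by (intro UnI2 image_eqI[of _ _ "x - t"]) auto
      qed (use x in auto)
    qed auto
    have "card (S \<inter> {..<t + k}) = card (S \<inter> {..<t}) + card ((\<lambda>i. i + t) ` ({i. i + t \<in> S} \<inter> {..<k}))"
      unfolding eq by (rule card_Un_disjoint) auto
    then show ?thesis by (simp add: a_def card_image)
  qed
  have "f t \<le> f 0" by (rule min) simp
  then have "a t \<le> \<delta> / 2 * t" by (simp add: f_def a_def)
  also have "\<dots> \<le> \<delta> / 2 * n" using t \<delta> by simp
  finally have at: "a t \<le> \<delta> / 2 * n" .
  have "card ({i. i + t \<in> S} \<inter> {..<n - t}) \<le> card {..<n - t}"
    by (rule card_mono) auto
  then have "a n \<le> a t + (real n - real t)"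
    using diff[of "n - t"] t by (simp add: of_nat_diff)
  moreover have "a n \<ge> \<delta> * n" using S by (simp add: a_def Int_absorb2)
  ultimately have nt: "\<delta> / 2 * n \<le> real n - real t" using at by (simp add: field_simps)
  show thesis
  proof
    fix k :: nat assume "k \<le> \<delta> / 2 * n"
    with nt t have "t + k \<le> n" by linarith
    then have "f t \<le> f (t + k)" by (rule min)
    then show "\<delta> / 2 * k \<le> card ({i. i + t \<in> S} \<inter> {..<k})"
      using diff[of k] by (simp add: f_def field_simps)
  qed
qed

text \<open>Members that are merely large need not accumulate, since their elements may lie ever farther apart.
  Translating them as in \<open>dense_set_leader\<close> makes all their initial segments dense, and
  then Koenig's lemma produces an infinite set.\<close>

lemma infinite_set_of_dense_family:
  fixes \<F> :: "nat set set" and \<delta> :: real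
  assumes \<delta>: "0 < \<delta>"
    and hered: "\<And>S S'. S \<in> \<F> \<Longrightarrow> S' \<subseteq> S \<Longrightarrow> S' \<in> \<F>"
    and shift: "\<And>S t. S \<in> \<F> \<Longrightarrow> {i. i + t \<in> S} \<in> \<F>"
    and dense: "\<And>N. \<exists>n\<ge>N. \<exists>S\<in>\<F>. S \<subseteq> {..<n} \<and> \<delta> * n \<le> card S"
  obtains I where "infinite I" "\<And>A. finite A \<Longrightarrow> A \<subseteq> I \<Longrightarrow> A \<in> \<F>"
proof -
  define long where "long S N \<longleftrightarrow> (\<forall>k\<le>N. \<delta> / 2 * k \<le> card (S \<inter> {..<k}))" for S and N :: nat
  have ex_long: "\<exists>S\<in>\<F>. long S N" for N
  proof -
    obtain n0 :: nat where n0: "N / (\<delta> / 2) \<le> n0" using real_arch_simple by blast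
    obtain n S where n: "n0 \<le> n" and S: "S \<in> \<F>" "S \<subseteq> {..<n}" "\<delta> * n \<le> card S"
      using dense by blast
    from dense_set_leader[OF \<delta> S(2,3)] obtain t where
      t: "\<And>k. k \<le> \<delta> / 2 * n \<Longrightarrow> \<delta> / 2 * k \<le> card ({i. i + t \<in> S} \<inter> {..<k})" by blast
    have "N \<le> \<delta> / 2 * n0" using n0 \<delta> by (simp add: field_simps)
    also have "\<dots> \<le> \<delta> / 2 * n" using n \<delta> by simp
    finally have "long {i. i + t \<in> S} N"
      unfolding long_def by (intro allI impI t) linarith
    then show ?thesis using shift[OF S(1)] by blast
  qed
  have long_mono: "long S N' \<Longrightarrow> N \<le> N' \<Longrightarrow> long S N" for S N N'
    by (auto simp: long_def)
  \<comment> \<open>\<open>A\<close> is the trace on \<open>{..<m}\<close> of members that are dense on arbitrarily long initial segments;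
    such traces form an infinite binary tree.\<close>
  define good where "good m A \<longleftrightarrow> (\<forall>N. \<exists>S\<in>\<F>. S \<inter> {..<m} = A \<and> long S N)" for m A
  have "\<exists>A. \<forall>m. good m (A m) \<and> A (Suc m) \<inter> {..<m} = A m"
  proof (rule dependent_nat_choice)
    show "\<exists>A. good 0 A" using ex_long by (auto simp: good_def)
  next
    fix A m assume A: "good m A"
    then have Asub: "A \<subseteq> {..<m}" by (auto simp: good_def)
    have "good (Suc m) A \<or> good (Suc m) (insert m A)"
    proof (rule ccontr)
      assume "\<not> ?thesis"
      then have "\<not> good (Suc m) A" "\<not> good (Suc m) (insert m A)" by simp_all
      then obtain N N' where N: "\<And>S. S \<in> \<F> \<Longrightarrow> long S N \<Longrightarrow> S \<inter> {..<Suc m} \<noteq> A"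
        and N': "\<And>S. S \<in> \<F> \<Longrightarrow> long S N' \<Longrightarrow> S \<inter> {..<Suc m} \<noteq> insert m A"
        unfolding good_def by metis
      obtain S where S: "S \<in> \<F>" "S \<inter> {..<m} = A" "long S (max N N')"
        using A unfolding good_def by metis
      have "S \<inter> {..<Suc m} = A \<or> S \<inter> {..<Suc m} = insert m A"
        using S(2) by (auto simp: lessThan_Suc)
      then show False
        using N[OF S(1)] N'[OF S(1)] long_mono[OF S(3)] by auto
    qed
    then show "\<exists>B. good (Suc m) B \<and> B \<inter> {..<m} = A"
      using Asub by (auto simp: Int_insert_left)
  qed
  then obtain A where good: "\<And>m. good m (A m)" and step: "\<And>m. A (Suc m) \<inter> {..<m} = A m"
    by blast
  have mono: "mono A" using step by (intro incseq_SucI) blast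
  have AF: "A m \<in> \<F>" for m
    using good[of m] hered unfolding good_def by (metis Int_lower1)
  have Asub: "A m \<subseteq> {..<m}" for m using good[of m] unfolding good_def by blast
  have Acard: "\<delta> / 2 * m \<le> card (A m)" for m
    using good[of m] unfolding good_def long_def by (metis order_refl)
  show thesis
  proof
    show "infinite (\<Union>m. A m)"
    proof
      assume fin: "finite (\<Union>m. A m)"
      obtain m :: nat where "card (\<Union>m. A m) / (\<delta> / 2) < m" using reals_Archimedean2 by blast
      then have "card (\<Union>m. A m) < \<delta> / 2 * m" using \<delta> by (simp add: field_simps)
      also have "\<dots> \<le> card (A m)" by (rule Acard)
      also have "\<dots> \<le> card (\<Union>m. A m)" using fin by (auto intro!: card_mono)
      finally show False by simp
    qed
  next
    fix B assume B: "finite B" "B \<subseteq> (\<Union>m. A m)"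
    then obtain m where "B \<subseteq> A m"
    proof (induction B arbitrary: thesis)
      case empty then show ?case by blast
    next
      case (insert x B)
      then obtain m where "B \<subseteq> A m" by blast
      moreover obtain m' where "x \<in> A m'" using insert by blast
      ultimately have "insert x B \<subseteq> A (max m m')"
        using monoD[OF mono, of m "max m m'"] monoD[OF mono, of m' "max m m'"] by auto
      then show ?case using insert by blast
    qed
    then show "B \<in> \<F>" using AF hered by blast
  qed
qed

section \<open>Joins of covers\<close>

lemma Inter_vimage_in_iterated_join:
  assumes "\<And>i. i < n \<Longrightarrow> f i \<in> \<U>"
  shows "(\<Inter>i<n. (T ^^ i) -` f i) \<in> iterated_join T \<U> n"
  using assms
proof (induction n)
  case (Suc n)
  have "(\<Inter>i<Suc n. (T ^^ i) -` f i) = (\<Inter>i<n. (T ^^ i) -` f i) \<inter> (T ^^ n) -` f n"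
    by (auto simp: lessThan_Suc)
  moreover have "(\<Inter>i<n. (T ^^ i) -` f i) \<in> iterated_join T \<U> n"
    using Suc by simp
  moreover have "(T ^^ n) -` f n \<in> (\<lambda>A. (T ^^ n) -` A) ` \<U>"
    using Suc.prems by simp
  ultimately show ?case unfolding iterated_join.simps cover_join_def by auto
qed simp

lemma min_subcover_card_le:
  assumes "\<V> \<subseteq> \<U>" "finite \<V>" "\<Union>\<V> = UNIV"
  shows "min_subcover_card \<U> \<le> card \<V>"
  unfolding min_subcover_card_def by (rule Least_le) (use assms in blast)

lemma min_subcover_card_pos:
  assumes "finite \<U>" "\<Union>\<U> = UNIV"
  shows "0 < min_subcover_card \<U>"
proof -
  have "\<exists>\<V>\<subseteq>\<U>. finite \<V> \<and> \<Union>\<V> = UNIV \<and> card \<V> = min_subcover_card \<U>"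
    unfolding min_subcover_card_def by (rule LeastI_ex) (use assms in blast)
  then obtain \<V> where "\<V> \<subseteq> \<U>" and \<V>: "finite \<V>" "\<Union>\<V> = UNIV" "card \<V> = min_subcover_card \<U>"
    by metis
  have "\<V> \<noteq> {}" using \<V>(2) by auto
  then have "0 < card \<V>" using \<V>(1) by (simp add: card_gt_0_iff)
  then show ?thesis using \<V>(3) by simp
qed

lemma finite_cover_iterated_join:
  assumes "finite \<U>" "\<Union>\<U> = UNIV"
  shows "finite (iterated_join T \<U> n) \<and> \<Union>(iterated_join T \<U> n) = UNIV"
proof (induction n)
  case (Suc n)
  let ?J = "iterated_join T \<U> n"
  have eq: "iterated_join T \<U> (Suc n) = (\<lambda>(A, B). A \<inter> (T ^^ n) -` B) ` (?J \<times> \<U>)"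
    by (auto simp: cover_join_def)
  have cov: "x \<in> \<Union>(iterated_join T \<U> (Suc n))" for x
  proof -
    obtain A where "A \<in> ?J" "x \<in> A" using Suc by blast
    moreover have "(T ^^ n) x \<in> \<Union>\<U>" using assms(2) by simp
    then obtain B where "B \<in> \<U>" "(T ^^ n) x \<in> B" by (rule UnionE)
    ultimately show ?thesis unfolding eq by blast
  qed
  show ?case
  proof
    show "finite (iterated_join T \<U> (Suc n))" unfolding eq using Suc assms(1) by simp
    show "\<Union>(iterated_join T \<U> (Suc n)) = UNIV" by (rule UNIV_eq_I[symmetric]) (rule cov)
  qed
qed simp

text \<open>The orbit of any \<open>y\<close> is described by some \<open>x \<in> V\<close>, by the set \<open>E\<close> of times at which \<open>y\<close> leaves the member
  of \<open>\<U>\<close> that \<open>x\<close> prescribes, and by corrections at these times. Each error time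
  contributes a separating coordinate, whence \<open>card E \<le> k\<close>.\<close>

lemma min_subcover_card_le_separated:
  fixes T :: "'a \<Rightarrow> 'a" and u :: "'a set \<Rightarrow> 'a set" and k :: real
  defines "P \<equiv> \<lambda>(i, F). (T ^^ i) -` F" and "Q \<equiv> \<lambda>(i, F). (T ^^ i) -` (- u F)"
  assumes \<F>: "finite \<F>" "\<Union>\<F> = UNIV" "\<And>F. F \<in> \<F> \<Longrightarrow> u F \<in> \<U> \<and> F \<subseteq> u F"
    and V: "finite V"
    and dense: "\<And>y. \<exists>x\<in>V. card (separators P Q ({..<n} \<times> \<F>) x y) \<le> k"
  shows "min_subcover_card (iterated_join T \<U> n)
    \<le> card V * (card {E. E \<subseteq> {..<n} \<and> card E \<le> k} * card \<F> powr k)"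
proof -
  have "\<exists>F. F \<in> \<F> \<and> x \<in> F" for x
    using UNIV_I[of x] unfolding \<F>(2)[symmetric] by auto
  then obtain w :: "'a \<Rightarrow> 'a set" where w: "\<And>x. w x \<in> \<F>" "\<And>x. x \<in> w x"
    by metis
  define \<E> where "\<E> = {E. E \<subseteq> {..<n} \<and> card E \<le> k}"
  define D where "D = V \<times> (SIGMA E:\<E>. E \<rightarrow>\<^sub>E \<F>)"
  define f where "f = (\<lambda>(x, E, g) i. u (if i \<in> E then g i else w ((T ^^ i) x)))"
  define \<V> where "\<V> = (\<lambda>d. \<Inter>i<n. (T ^^ i) -` f d i) ` D"
  have "finite (Pow {..<n})" by simp
  then have fin\<E>: "finite \<E>" "\<And>E. E \<in> \<E> \<Longrightarrow> finite E"
    by (auto simp: \<E>_def intro: finite_subset[of _ "Pow {..<n}"] finite_subset[of _ "{..<n}"])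
  have finPi: "finite (E \<rightarrow>\<^sub>E \<F>)" if "E \<in> \<E>" for E
    using fin\<E>(2)[OF that] \<F>(1) by (rule finite_PiE)
  have finS: "finite (SIGMA E:\<E>. E \<rightarrow>\<^sub>E \<F>)"
    using fin\<E>(1) finPi by (rule finite_SigmaI)
  have finD: "finite D" unfolding D_def using V finS by simp
  have "\<F> \<noteq> {}" using \<F>(2) by auto
  then have m: "1 \<le> card \<F>" using \<F>(1) by (simp add: Suc_le_eq card_gt_0_iff)
  have "\<V> \<subseteq> iterated_join T \<U> n"
  proof -
    have "f d i \<in> \<U>" if "d \<in> D" for d i
      using that w(1) \<F>(3) by (auto simp: D_def f_def PiE_iff split: if_splits)
    then show ?thesis unfolding \<V>_def by (auto intro: Inter_vimage_in_iterated_join)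
  qed
  moreover have "finite \<V>" unfolding \<V>_def using finD by simp
  moreover have "y \<in> \<Union>\<V>" for y
  proof -
    obtain x where x: "x \<in> V" "card (separators P Q ({..<n} \<times> \<F>) x y) \<le> k"
      using dense by blast
    define E where "E = {i\<in>{..<n}. (T ^^ i) y \<notin> u (w ((T ^^ i) x))}"
    have "card E = card ((\<lambda>i. (i, w ((T ^^ i) x))) ` E)"
      by (rule card_image[symmetric]) (auto simp: inj_on_def)
    also have "\<dots> \<le> card (separators P Q ({..<n} \<times> \<F>) x y)"
      by (rule card_mono) (use \<F>(1) w in \<open>auto simp: separators_def E_def P_def Q_def\<close>)
    finally have "E \<in> \<E>" using x(2) by (auto simp: \<E>_def E_def)
    then have "(x, E, restrict (\<lambda>i. w ((T ^^ i) y)) E) \<in> D" (is "?d \<in> D")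
      using x(1) w(1) by (auto simp: D_def)
    moreover have "y \<in> (T ^^ i) -` f ?d i" if "i < n" for i
    proof (cases "i \<in> E")
      case True
      then show ?thesis using w[of "(T ^^ i) y"] \<F>(3) by (auto simp: f_def)
    next
      case False
      then show ?thesis using that by (auto simp: f_def E_def)
    qed
    ultimately show ?thesis unfolding \<V>_def by blast
  qed
  ultimately have "min_subcover_card (iterated_join T \<U> n) \<le> card \<V>"
    by (intro min_subcover_card_le) auto
  also have "\<dots> \<le> card D" unfolding \<V>_def using finD by (rule card_image_le)
  also have "\<dots> = card V * (\<Sum>E\<in>\<E>. card \<F> ^ card E)"
    unfolding D_def card_cartesian_product using fin\<E> finPi
    by (simp add: card_SigmaI card_funcsetE)
  finally have "real (min_subcover_card (iterated_join T \<U> n)) \<le> card V * (\<Sum>E\<in>\<E>. real (card \<F>) ^ card E)"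
    by (metis (mono_tags, lifting) of_nat_le_iff of_nat_mult of_nat_power of_nat_sum sum.cong)
  also have "\<dots> \<le> card V * (\<Sum>E\<in>\<E>. card \<F> powr k)"
  proof (intro mult_left_mono sum_mono)
    fix E assume "E \<in> \<E>"
    then have "card \<F> powr card E \<le> card \<F> powr k"
      using m by (intro powr_mono) (auto simp: \<E>_def)
    then show "real (card \<F>) ^ card E \<le> card \<F> powr k"
      using m by (simp add: powr_realpow)
  qed simp
  finally show ?thesis by (simp add: \<E>_def)
qed

lemma pigeonhole_fibre:
  fixes \<delta> :: real
  assumes "finite \<F>" "S \<subseteq> {..<n} \<times> \<F>" "\<delta> * (n * card \<F>) < card S"
  shows "\<exists>F\<in>\<F>. \<delta> * n < card {i. (i, F) \<in> S}"
proof (rule ccontr)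
  assume "\<not> ?thesis"
  then have le: "card {i. (i, F) \<in> S} \<le> \<delta> * n" if "F \<in> \<F>" for F
    using that by (auto simp: not_less)
  have fin: "finite {i. (i, F) \<in> S}" for F
    by (rule finite_subset[of _ "{..<n}"]) (use assms(2) in auto)
  have "S = (\<lambda>(F, i). (i, F)) ` (SIGMA F:\<F>. {i. (i, F) \<in> S})"
    using assms(2) by force
  then have "card S \<le> card (SIGMA F:\<F>. {i. (i, F) \<in> S})"
    using card_image_le[of "SIGMA F:\<F>. {i. (i, F) \<in> S}" "\<lambda>(F, i). (i, F)"] assms(1) fin by auto
  also have "\<dots> = (\<Sum>F\<in>\<F>. card {i. (i, F) \<in> S})"
    using assms(1) fin by (simp add: card_SigmaI)
  finally have "real (card S) \<le> (\<Sum>F\<in>\<F>. real (card {i. (i, F) \<in> S}))"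
    by (metis of_nat_le_iff of_nat_sum)
  also have "\<dots> \<le> (\<Sum>F\<in>\<F>. \<delta> * n)" by (rule sum_mono) (rule le)
  finally show False using assms(3) by (simp add: mult.commute mult.left_commute)
qed

section \<open>Exponential growth gives dense independent sets\<close>

text \<open>The coordinates are the pairs of a time \<open>i < n\<close> and a member \<open>F\<close> of the closed cover. If no set of
  more than \<open>\<delta> * (n * card \<F>)\<close> coordinates is shattered, then any separated set \<open>V\<close> has at most
  \<open>exp (c / 2 * n)\<close> points, because \<open>card V powr p\<close> is at most the number of sparse sets of coordinates.
  A maximal one therefore exists and yields a subcover of at most \<open>exp (c * n)\<close> members.
  The passage from coordinates to times for a single \<open>F\<close> is a pigeonhole argument.\<close>

lemma exponential_growth_imp_dense_shattering:
  fixes T :: "'a \<Rightarrow> 'a" and c :: real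
  assumes \<F>: "finite \<F>" "\<Union>\<F> = UNIV" "\<And>F. F \<in> \<F> \<Longrightarrow> u F \<in> \<U> \<and> F \<subseteq> u F"
    and c: "0 < c"
  obtains \<delta> :: real where "0 < \<delta>"
    "\<And>n. exp (c * n) < min_subcover_card (iterated_join T \<U> n) \<Longrightarrow>
       \<exists>F\<in>\<F>. \<exists>S\<subseteq>{..<n}. \<delta> * n \<le> card S \<and>
         shatters (\<lambda>i. (T ^^ i) -` F) (\<lambda>i. (T ^^ i) -` (- u F)) UNIV S"
proof -
  define m where "m = card \<F>"
  have "\<F> \<noteq> {}" using \<F>(2) by auto
  then have m: "1 \<le> m" using \<F>(1) by (simp add: m_def Suc_le_eq card_gt_0_iff)
  obtain \<epsilon> :: real where \<epsilon>: "0 < \<epsilon>" "\<epsilon> \<le> 1" and small: "\<And>Z :: nat set. finite Z \<Longrightarrow>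
       card {S. S \<subseteq> Z \<and> card S \<le> \<epsilon> * card Z} * real m powr (\<epsilon> * card Z) \<le> exp (c / 2 * card Z)"
    using few_small_subsets[of m "c / 2"] m c by auto
  \<comment> \<open>The constant of \<open>separated_balanced_coordinate\<close> for \<open>k = \<epsilon> * n\<close> and \<open>n * m\<close> coordinates.\<close>
  define \<eta> where "\<eta> = \<epsilon> / (4 * m)"
  have \<eta>: "0 < \<eta>" "\<eta> < 1" using \<epsilon> m by (auto simp: \<eta>_def field_simps)
  define p where "p = ln 2 / ln (1 / \<eta>)"
  have p: "0 < p" using \<eta> by (simp add: p_def)
  have "p * ln \<eta> = - ln 2" using \<eta> by (simp add: p_def ln_div)
  then have \<eta>p: "2 * \<eta> powr p = 1" using \<eta> by (simp add: powr_def exp_minus)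
  obtain \<delta> :: real where \<delta>: "0 < \<delta>" and small': "\<And>Z :: (nat \<times> 'a set) set. finite Z \<Longrightarrow>
       card {S. S \<subseteq> Z \<and> card S \<le> \<delta> * card Z} * 1 powr (\<delta> * card Z) \<le> exp (p * c / (2 * m) * card Z)"
    using few_small_subsets[of 1 "p * c / (2 * m)"] p c m by auto
  show thesis
  proof
    show "0 < \<delta>" by fact
    fix n :: nat
    define P where "P = (\<lambda>(i, F). (T ^^ i) -` F)"
    define Q where "Q = (\<lambda>(i, F). (T ^^ i) -` (- u F))"
    define Z where "Z = {..<n} \<times> \<F>"
    assume big: "exp (c * n) < min_subcover_card (iterated_join T \<U> n)"
    have n: "0 < n"
    proof (rule ccontr)
      assume "\<not> 0 < n"
      moreover have "min_subcover_card {UNIV :: 'a set} \<le> card {UNIV :: 'a set}"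
        by (rule min_subcover_card_le) auto
      ultimately show False using big by simp
    qed
    have Z: "finite Z" "card Z = n * m" using \<F>(1) by (auto simp: Z_def m_def card_cartesian_product)
    have disj: "P z \<inter> Q z = {}" if "z \<in> Z" for z
      using that \<F>(3) by (auto simp: Z_def P_def Q_def)
    have "\<exists>S\<subseteq>Z. \<delta> * card Z < card S \<and> shatters P Q UNIV S"
    proof (rule ccontr)
      assume contra: "\<not> ?thesis"
      define sep where "sep V \<longleftrightarrow> finite V \<and> pairwise (\<lambda>x y. \<epsilon> * n < card (separators P Q Z x y)) V" for V
      have bound: "card V \<le> exp (c / 2 * n)" if V: "sep V" for V
      proof (cases "V = {}")
        case False
        have split: "\<exists>z\<in>Z. \<eta> * card W \<le> card (W \<inter> P z) \<and> \<eta> * card W \<le> card (W \<inter> Q z)"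
          if W: "W \<subseteq> V" "2 \<le> card W" for W
        proof -
          have "\<epsilon> * n / (4 * card Z) = \<eta>" using n m by (simp add: \<eta>_def Z(2) field_simps)
          moreover have "pairwise (\<lambda>x y. \<epsilon> * n \<le> card (separators P Q Z x y)) W"
            using V W(1) by (auto simp: sep_def pairwise_def intro: less_imp_le)
          moreover have "finite W" using V W(1) by (auto simp: sep_def intro: finite_subset)
          ultimately show ?thesis
            using separated_balanced_coordinate[of Z W "\<epsilon> * n" P Q] Z(1) W(2) \<epsilon> n by simp
        qed
        have "card V powr p \<le> card {S. S \<subseteq> Z \<and> shatters P Q V S}"
          by (rule card_shattered_ge[where \<eta> = \<eta>])
             (use Z disj p \<eta> \<eta>p V False split in \<open>auto simp: sep_def\<close>)
        also have "\<dots> \<le> card {S. S \<subseteq> Z \<and> card S \<le> \<delta> * card Z}"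
        proof -
          have "{S. S \<subseteq> Z \<and> shatters P Q V S} \<subseteq> {S. S \<subseteq> Z \<and> card S \<le> \<delta> * card Z}"
          proof clarify
            fix S assume S: "S \<subseteq> Z" "shatters P Q V S"
            then have "shatters P Q UNIV S" using shatters_mono by blast
            then show "card S \<le> \<delta> * card Z" using contra S(1) not_less by blast
          qed
          then show ?thesis using Z(1) by (simp add: card_mono)
        qed
        also have "\<dots> \<le> exp (p * c / (2 * m) * card Z)" using small'[OF Z(1)] by simp
        also have "\<dots> = exp (c / 2 * n) powr p"
          using m by (simp add: Z(2) powr_def field_simps)
        finally show ?thesis
          using powr_less_mono2[OF p, of "exp (c / 2 * n)" "card V"] by (meson exp_ge_zero not_le)
      qed simp
      have "\<exists>V. sep V \<and> (\<forall>W. sep W \<longrightarrow> card W \<le> card V)"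
      proof (rule ex_has_greatest_nat)
        show "sep {}" by (simp add: sep_def)
        show "\<forall>V. sep V \<longrightarrow> card V < Suc (nat \<lceil>exp (c / 2 * n)\<rceil>)"
        proof (intro allI impI)
          fix V assume "sep V"
          then have "real (card V) \<le> exp (c / 2 * n)" by (rule bound)
          also have "\<dots> \<le> real (nat \<lceil>exp (c / 2 * n)\<rceil>)" by (rule real_nat_ceiling_ge)
          finally show "card V < Suc (nat \<lceil>exp (c / 2 * n)\<rceil>)"
            by (simp only: of_nat_le_iff less_Suc_eq_le)
        qed
      qed
      then obtain V where V: "sep V" and max: "\<And>W. sep W \<Longrightarrow> card W \<le> card V" by blast
      have "\<exists>x\<in>V. card (separators P Q Z x y) \<le> \<epsilon> * n" for y
      proof (rule ccontr)
        assume far: "\<not> ?thesis"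
        have self: "separators P Q Z y y = {}" using disj by (auto simp: separators_def)
        have "y \<notin> V" using far self \<epsilon> by auto
        have sym: "separators P Q Z x x' = separators P Q Z x' x" for x x'
          by (auto simp: separators_def)
        have "sep (insert y V)"
          using V far sym by (auto simp: sep_def pairwise_insert not_le)
        from max[OF this] \<open>y \<notin> V\<close> V show False by (simp add: sep_def)
      qed
      then have "min_subcover_card (iterated_join T \<U> n)
          \<le> card V * (card {E. E \<subseteq> {..<n} \<and> card E \<le> \<epsilon> * n} * card \<F> powr (\<epsilon> * n))"
        using V unfolding P_def Q_def Z_def sep_def
        by (intro min_subcover_card_le_separated[OF \<F>]) auto
      also have "\<dots> \<le> exp (c / 2 * n) * exp (c / 2 * n)"
        using bound[OF V] small[of "{..<n}"] by (intro mult_mono) (auto simp: m_def)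
      also have "\<dots> = exp (c * n)" by (simp flip: exp_add)
      finally show False using big by simp
    qed
    then obtain S where S: "S \<subseteq> Z" "\<delta> * card Z < card S" "shatters P Q UNIV S" by blast
    then obtain F where F: "F \<in> \<F>" "\<delta> * n < card {i. (i, F) \<in> S}"
      using pigeonhole_fibre[OF \<F>(1), of S n \<delta>] Z unfolding Z_def m_def by auto
    have "shatters (\<lambda>i. (T ^^ i) -` F) (\<lambda>i. (T ^^ i) -` (- u F)) UNIV {i. (i, F) \<in> S}"
      unfolding shatters_def
    proof (intro allI impI)
      fix \<sigma> assume "\<sigma> \<subseteq> {i. (i, F) \<in> S}"
      then have "(\<lambda>i. (i, F)) ` \<sigma> \<subseteq> S" by blast
      from shattersE[OF S(3) this] obtain x where
        "\<And>z. z \<in> (\<lambda>i. (i, F)) ` \<sigma> \<Longrightarrow> x \<in> P z" "\<And>z. z \<in> S - (\<lambda>i. (i, F)) ` \<sigma> \<Longrightarrow> x \<in> Q z"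
        by metis
      then have "(\<forall>i\<in>\<sigma>. x \<in> (T ^^ i) -` F) \<and> (\<forall>i\<in>{i. (i, F) \<in> S} - \<sigma>. x \<in> (T ^^ i) -` (- u F))"
        unfolding P_def Q_def by fastforce
      then show "\<exists>x\<in>UNIV. (\<forall>i\<in>\<sigma>. x \<in> (T ^^ i) -` F) \<and> (\<forall>i\<in>{i. (i, F) \<in> S} - \<sigma>. x \<in> (T ^^ i) -` (- u F))"
        by blast
    qed
    moreover have "{i. (i, F) \<in> S} \<subseteq> {..<n}" using S(1) by (auto simp: Z_def)
    ultimately show "\<exists>F\<in>\<F>. \<exists>S\<subseteq>{..<n}. \<delta> * n \<le> card S \<and>
         shatters (\<lambda>i. (T ^^ i) -` F) (\<lambda>i. (T ^^ i) -` (- u F)) UNIV S"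
      using F by (intro bexI[of _ F] exI[of _ "{i. (i, F) \<in> S}"]) auto
  qed
qed

lemma shatters_shift:
  fixes T :: "'a \<Rightarrow> 'a"
  assumes "shatters (\<lambda>i. (T ^^ i) -` F) (\<lambda>i. (T ^^ i) -` G) UNIV S"
  shows "shatters (\<lambda>i. (T ^^ i) -` F) (\<lambda>i. (T ^^ i) -` G) UNIV {i. i + t \<in> S}"
  unfolding shatters_def
proof (intro allI impI)
  fix \<sigma> assume "\<sigma> \<subseteq> {i. i + t \<in> S}"
  then have "(\<lambda>i. i + t) ` \<sigma> \<subseteq> S" by blast
  from shattersE[OF assms this] obtain x where
    x: "\<And>i. i \<in> (\<lambda>i. i + t) ` \<sigma> \<Longrightarrow> x \<in> (T ^^ i) -` F"
    "\<And>i. i \<in> S - (\<lambda>i. i + t) ` \<sigma> \<Longrightarrow> x \<in> (T ^^ i) -` G" by metis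
  have comp: "(T ^^ i) ((T ^^ t) x) = (T ^^ (i + t)) x" for i by (simp add: funpow_add)
  have "(\<forall>i\<in>\<sigma>. (T ^^ t) x \<in> (T ^^ i) -` F) \<and> (\<forall>i\<in>{i. i + t \<in> S} - \<sigma>. (T ^^ t) x \<in> (T ^^ i) -` G)"
    using x(1)[of "i + t" for i] x(2)[of "i + t" for i] by (auto simp: comp image_iff)
  then show "\<exists>x\<in>UNIV. (\<forall>i\<in>\<sigma>. x \<in> (T ^^ i) -` F) \<and> (\<forall>i\<in>{i. i + t \<in> S} - \<sigma>. x \<in> (T ^^ i) -` G)"
    by blast
qed

section \<open>Tameness excludes infinite independent sets\<close>

lemma compact_shatters:
  fixes P Q :: "'z \<Rightarrow> 'a::topological_space set"
  assumes "compact (UNIV :: 'a set)" "\<And>z. closed (P z)" "\<And>z. closed (Q z)"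
    and fin: "\<And>A. finite A \<Longrightarrow> A \<subseteq> I \<Longrightarrow> shatters P Q UNIV A"
  shows "shatters P Q UNIV I"
  unfolding shatters_def
proof (intro allI impI)
  fix \<sigma> assume "\<sigma> \<subseteq> I"
  define C where "C z = (if z \<in> \<sigma> then P z else Q z)" for z
  have "UNIV \<inter> (\<Inter>z\<in>I. C z) \<noteq> {}"
  proof (rule compact_imp_fip_image)
    fix A assume A: "finite A" "A \<subseteq> I"
    from shattersE[OF fin[OF A], of "\<sigma> \<inter> A"] obtain x where
      "\<And>z. z \<in> \<sigma> \<inter> A \<Longrightarrow> x \<in> P z" "\<And>z. z \<in> A - \<sigma> \<inter> A \<Longrightarrow> x \<in> Q z"
      by auto
    then have "x \<in> (\<Inter>z\<in>A. C z)" by (auto simp: C_def)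
    then show "UNIV \<inter> (\<Inter>z\<in>A. C z) \<noteq> {}" by blast
  qed (use assms in \<open>auto simp: C_def\<close>)
  then obtain x where x: "\<And>z. z \<in> I \<Longrightarrow> x \<in> C z" by blast
  have "(\<forall>z\<in>\<sigma>. x \<in> P z) \<and> (\<forall>z\<in>I - \<sigma>. x \<in> Q z)"
  proof (intro conjI ballI)
    fix z assume "z \<in> \<sigma>" then show "x \<in> P z" using x[of z] \<open>\<sigma> \<subseteq> I\<close> by (auto simp: C_def)
  next
    fix z assume "z \<in> I - \<sigma>" then show "x \<in> Q z" using x[of z] by (auto simp: C_def)
  qed
  then show "\<exists>x\<in>UNIV. (\<forall>z\<in>\<sigma>. x \<in> P z) \<and> (\<forall>z\<in>I - \<sigma>. x \<in> Q z)" by blast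
qed

lemma compact_UNIV_fun:
  assumes "compact (UNIV :: 'b::topological_space set)"
  shows "compact (UNIV :: ('a \<Rightarrow> 'b) set)"
proof -
  have "compact_space (product_topology (\<lambda>_ :: 'a. euclidean :: 'b topology) UNIV)"
    unfolding compact_space_product_topology using assms by (simp add: compact_space_def)
  then show ?thesis by (simp add: euclidean_product_topology compact_space_def)
qed

lemma compact_t2_regular:
  fixes A :: "'a::t2_space set"
  assumes "compact (UNIV :: 'a set)" "open A" "x \<in> A"
  obtains W where "open W" "x \<in> W" "closure W \<subseteq> A"
proof -
  have "Hausdorff_space (euclidean :: 'a topology)"
    unfolding Hausdorff_space_def
  proof (intro allI impI)
    fix x y :: 'a
    assume "x \<in> topspace euclidean \<and> y \<in> topspace euclidean \<and> x \<noteq> y"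
    then obtain U V where "open U" "open V" "x \<in> U" "y \<in> V" "U \<inter> V = {}"
      using hausdorff[of x y] by blast
    then show "\<exists>U V. openin euclidean U \<and> openin euclidean V \<and> x \<in> U \<and> y \<in> V \<and> disjnt U V"
      by (auto simp: disjnt_def)
  qed
  then have "regular_space (euclidean :: 'a topology)"
    using assms(1) by (intro compact_Hausdorff_imp_regular_space) (simp_all add: compact_space_def)
  then have "\<exists>W. openin euclidean W \<and> x \<in> W \<and> disjnt (- A) (euclidean closure_of W)"
    using assms(2,3) unfolding regular_space by (auto simp: closed_Compl)
  then show thesis using that by (auto simp: disjnt_def)
qed

text \<open>Closed sets are what makes independence pass to limits, both from finite to infinite sets of times
  and along convergent iterates.\<close>

lemma closed_cover_refinement:
  fixes \<U> :: "'a::t2_space set set"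
  assumes "compact (UNIV :: 'a set)" "\<And>A. A \<in> \<U> \<Longrightarrow> open A" "\<Union>\<U> = UNIV"
  obtains \<F> u where "finite \<F>" "\<Union>\<F> = UNIV"
    "\<And>F. F \<in> \<F> \<Longrightarrow> closed F \<and> u F \<in> \<U> \<and> F \<subseteq> u F"
proof -
  have "\<exists>W. open W \<and> x \<in> W \<and> (\<exists>A\<in>\<U>. closure W \<subseteq> A)" for x :: 'a
  proof -
    have "x \<in> \<Union>\<U>" using assms(3) by simp
    then obtain A where A: "A \<in> \<U>" "x \<in> A" by (rule UnionE)
    obtain W where "open W" "x \<in> W" "closure W \<subseteq> A"
      using compact_t2_regular[OF assms(1) assms(2)[OF A(1)] A(2)] .
    then show ?thesis using A(1) by blast
  qed
  then obtain W where W: "\<And>x :: 'a. open (W x)" "\<And>x. x \<in> W x" "\<And>x. \<exists>A\<in>\<U>. closure (W x) \<subseteq> A"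
    by metis
  obtain C where C: "finite C" "UNIV \<subseteq> (\<Union>x\<in>C. W x)"
    by (rule compactE_image[OF assms(1), of UNIV W]) (use W in auto)
  define \<F> where "\<F> = (\<lambda>x. closure (W x)) ` C"
  have "\<exists>A. A \<in> \<U> \<and> F \<subseteq> A" if "F \<in> \<F>" for F
    using that W(3) unfolding \<F>_def by auto
  then obtain u where u: "\<And>F. F \<in> \<F> \<Longrightarrow> u F \<in> \<U> \<and> F \<subseteq> u F" by metis
  show thesis
  proof (rule that[of \<F> u])
    show "finite \<F>" using C(1) by (simp add: \<F>_def)
    have "x \<in> \<Union>\<F>" for x
    proof -
      obtain y where "y \<in> C" "x \<in> W y" using C(2) by auto
      then show ?thesis using closure_subset[of "W y"] by (auto simp: \<F>_def)
    qed
    then show "\<Union>\<F> = UNIV" by auto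
    show "closed F \<and> u F \<in> \<U> \<and> F \<subseteq> u F" if "F \<in> \<F>" for F
      using u that by (auto simp: \<F>_def)
  qed
qed

lemma frequently_closed_limit:
  assumes "(f \<longlongrightarrow> l) F" "closed C" "\<exists>\<^sub>F n in F. f n \<in> C"
  shows "l \<in> C"
proof (rule ccontr)
  assume "l \<notin> C"
  then have "\<forall>\<^sub>F n in F. f n \<in> - C"
    using assms(1,2) by (intro topological_tendstoD) auto
  then show False using assms(3) by (auto simp: frequently_def)
qed

text \<open>For uncountable \<open>'a\<close> the compact space \<open>'a \<Rightarrow> 'a\<close> need not be sequentially compact; an infinite set of
  iterates only has an accumulation point \<open>p\<close>. The Frechet property turns \<open>p\<close> into the limit
  of a sequence of iterates different from \<open>p\<close>, and such a sequence takes no value infinitely often.\<close>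

lemma tame_convergent_iterates:
  fixes T :: "'a::t2_space \<Rightarrow> 'a"
  assumes K: "compact (UNIV :: 'a set)" and "tame T"
    and I: "infinite I" and inj: "inj_on (\<lambda>i. T ^^ i) I"
  obtains i :: "nat \<Rightarrow> nat" and p where "range i \<subseteq> I" "infinite (range i)"
    "\<And>x. (\<lambda>n. (T ^^ i n) x) \<longlonglongrightarrow> p x"
proof -
  define E where "E = enveloping_semigroup T"
  define A where "A = (\<lambda>i. T ^^ i) ` I"
  have "T ^^ i = int_iterate T (int i)" for i by (simp add: int_iterate_def)
  then have "A \<subseteq> range (int_iterate T)" by (auto simp: A_def)
  then have AE: "A \<subseteq> E" unfolding E_def enveloping_semigroup_def using closure_subset by blast
  have "compact E" unfolding E_def enveloping_semigroup_def
    using compact_Int_closed[OF compact_UNIV_fun[OF K] closed_closure] by simp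
  moreover have "infinite A" unfolding A_def using I inj by (simp add: finite_image_iff)
  ultimately obtain p where p: "p \<in> E" "p islimpt A"
    using Heine_Borel_imp_Bolzano_Weierstrass AE by blast
  have "E \<inter> (A - {p}) = A - {p}" using AE by blast
  then have "p \<in> top_of_set E closure_of (A - {p})"
    using p by (simp add: islimpt_in_closure closure_of_subtopology)
  moreover have "A - {p} \<subseteq> topspace (top_of_set E)" using AE by auto
  moreover have "frechet_urysohn_space (top_of_set E)"
    using \<open>tame T\<close> by (simp add: tame_def E_def)
  ultimately have "\<exists>g :: nat \<Rightarrow> 'a \<Rightarrow> 'a. range g \<subseteq> A - {p} \<and> limitin (top_of_set E) g p sequentially"
    by (simp only: frechet_urysohn_space_def)
  then obtain g :: "nat \<Rightarrow> 'a \<Rightarrow> 'a"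
    where g: "range g \<subseteq> A - {p}" "limitin (top_of_set E) g p sequentially" by (elim exE conjE)
  have "\<forall>n. \<exists>i. i \<in> I \<and> g n = T ^^ i" using g(1) by (auto simp: A_def)
  then obtain i where i: "\<And>n. i n \<in> I" "\<And>n. g n = T ^^ i n" by metis
  have "limitin euclidean g p sequentially" using g(2) by (simp add: limitin_subtopology)
  then have lim: "(\<lambda>n. g n x) \<longlonglongrightarrow> p x" for x
    unfolding euclidean_product_topology[symmetric] limitin_componentwise by simp
  have "infinite (range i)"
  proof
    assume "finite (range i)"
    then obtain m where "infinite {n. i n = i m}"
      using pigeonhole_infinite[of UNIV i] by auto
    then have "\<exists>\<^sub>F n in sequentially. i n = i m"
      by (simp add: frequently_cofinite flip: cofinite_eq_sequentially)
    then have "\<exists>\<^sub>F n in sequentially. g n x \<in> {g m x}" for x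
      by (rule frequently_elim1) (simp add: i(2))
    then have "p x \<in> {g m x}" for x by (intro frequently_closed_limit[OF lim]) auto
    then have "p = g m" by auto
    then show False using g(1) by auto
  qed
  then show thesis using that[of i p] i lim by auto
qed

text \<open>Split the times of a convergent sequence of iterates into two infinite sets. A point that visits
  \<open>F\<close> at the times in the first one and \<open>G\<close> at all other times of \<open>I\<close> has its image under the limit in
  both closed sets.\<close>

lemma tame_not_shatters_infinite:
  fixes T :: "'a::t2_space \<Rightarrow> 'a"
  assumes K: "compact (UNIV :: 'a set)" and tame: "tame T"
    and FG: "closed F" "closed G" "F \<inter> G = {}" and I: "infinite I"
  shows "\<not> shatters (\<lambda>i. (T ^^ i) -` F) (\<lambda>i. (T ^^ i) -` G) UNIV I"
proof
  assume sh: "shatters (\<lambda>i. (T ^^ i) -` F) (\<lambda>i. (T ^^ i) -` G) UNIV I"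
  have "inj_on (\<lambda>i. T ^^ i) I"
  proof (rule inj_onI, rule ccontr)
    fix i j assume ij: "i \<in> I" "j \<in> I" "T ^^ i = T ^^ j" "i \<noteq> j"
    from shattersE[OF sh, of "{i}"] ij obtain x where "(T ^^ i) x \<in> F" "(T ^^ j) x \<in> G" by auto
    then show False using ij(3) FG(3) by auto
  qed
  from tame_convergent_iterates[OF K tame I this] obtain i p where
    i: "range i \<subseteq> I" "infinite (range i)" and lim: "\<And>x. (\<lambda>n. (T ^^ i n) x) \<longlonglongrightarrow> p x" by metis
  from infinite_infinite_partition[OF i(2)] obtain C :: "nat \<Rightarrow> nat set" where
    C: "pairwise (\<lambda>i j. disjnt (C i) (C j)) UNIV" "(\<Union>i. C i) \<subseteq> range i" "\<And>i. infinite (C i)" by metis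
  have disj: "C 0 \<inter> C 1 = {}" using C(1) by (auto simp: pairwise_def disjnt_def)
  have sub: "C k \<subseteq> range i" for k using C(2) by blast
  have freq: "\<exists>\<^sub>F n in sequentially. i n \<in> C k" for k
  proof -
    have "i ` {n. i n \<in> C k} = C k" using sub[of k] by auto
    then have "infinite {n. i n \<in> C k}" using C(3)[of k] by (metis finite_imageI)
    then show ?thesis by (simp add: frequently_cofinite flip: cofinite_eq_sequentially)
  qed
  have "C 0 \<subseteq> I" using sub i(1) by blast
  from shattersE[OF sh this] obtain x where
    x: "\<And>j. j \<in> C 0 \<Longrightarrow> (T ^^ j) x \<in> F" "\<And>j. j \<in> I - C 0 \<Longrightarrow> (T ^^ j) x \<in> G"
    by (metis vimageD)
  have "p x \<in> F"
    by (rule frequently_closed_limit[OF lim FG(1)], rule frequently_elim1[OF freq[of 0]]) (rule x)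
  moreover have "p x \<in> G"
  proof (rule frequently_closed_limit[OF lim FG(2)], rule frequently_elim1[OF freq[of 1]])
    fix n assume "i n \<in> C 1"
    then have "i n \<in> I - C 0" using disj i(1) by auto
    then show "(T ^^ i n) x \<in> G" by (rule x)
  qed
  ultimately show False using FG(3) by blast
qed

section \<open>Entropy\<close>

lemma tame_join_growth:
  fixes T :: "'a::t2_space \<Rightarrow> 'a" and c :: real
  assumes K: "compact (UNIV :: 'a set)" and T: "continuous_on UNIV T" and tame: "tame T"
    and \<U>: "finite_open_cover \<U>" and c: "0 < c"
  shows "\<forall>\<^sub>F n in sequentially. min_subcover_card (iterated_join T \<U> n) \<le> exp (c * n)"
proof (rule ccontr)
  assume "\<not> ?thesis"
  then have freq: "\<exists>\<^sub>F n in sequentially. exp (c * n) < min_subcover_card (iterated_join T \<U> n)"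
    by (simp add: frequently_def not_less)
  obtain \<F> u where \<F>: "finite \<F>" "\<Union>\<F> = UNIV" "\<And>F. F \<in> \<F> \<Longrightarrow> closed F \<and> u F \<in> \<U> \<and> F \<subseteq> u F"
    using closed_cover_refinement[OF K, of \<U>] \<U> unfolding finite_open_cover_def by metis
  define ind where "ind F S \<longleftrightarrow> shatters (\<lambda>i. (T ^^ i) -` F) (\<lambda>i. (T ^^ i) -` (- u F)) UNIV S"
    for F and S :: "nat set"
  have \<F>': "\<And>F. F \<in> \<F> \<Longrightarrow> u F \<in> \<U> \<and> F \<subseteq> u F" using \<F>(3) by blast
  from exponential_growth_imp_dense_shattering[where u = u and \<F> = \<F> and \<U> = \<U> and T = T, OF \<F>(1,2) \<F>' c]
  obtain \<delta> :: real where \<delta>: "0 < \<delta>" and ex: "\<And>n. exp (c * n) < min_subcover_card (iterated_join T \<U> n) \<Longrightarrow>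
       \<exists>F\<in>\<F>. \<exists>S\<subseteq>{..<n}. \<delta> * n \<le> card S \<and> ind F S" unfolding ind_def by metis
  have "\<exists>\<^sub>F n in sequentially. \<exists>F\<in>\<F>. \<exists>S\<subseteq>{..<n}. \<delta> * n \<le> card S \<and> ind F S"
    by (rule frequently_elim1[OF freq]) (rule ex)
  then have "\<exists>F\<in>\<F>. \<exists>\<^sub>F n in sequentially. \<exists>S\<subseteq>{..<n}. \<delta> * n \<le> card S \<and> ind F S"
    by (rule frequently_bex_finite[OF \<F>(1)])
  then obtain F where F: "F \<in> \<F>" "\<exists>\<^sub>F n in sequentially. \<exists>S\<subseteq>{..<n}. \<delta> * n \<le> card S \<and> ind F S" by blast
  obtain I where I: "infinite I" "\<And>A. finite A \<Longrightarrow> A \<subseteq> I \<Longrightarrow> A \<in> {S. ind F S}"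
  proof (rule infinite_set_of_dense_family[of \<delta> "{S. ind F S}"])
    show "\<exists>n\<ge>N. \<exists>S\<in>{S. ind F S}. S \<subseteq> {..<n} \<and> \<delta> * n \<le> card S" for N
      using F(2) unfolding frequently_sequentially by (metis mem_Collect_eq)
  qed (use \<delta> in \<open>auto simp: ind_def intro: shatters_mono shatters_shift\<close>)
  have contn: "continuous_on UNIV (T ^^ i)" for i
    by (induction i) (auto intro: continuous_on_compose2[OF T] simp: o_def)
  have cl: "closed F" "closed (- u F)" "F \<inter> - u F = {}"
    using \<F>(3)[OF F(1)] \<U> by (auto simp: finite_open_cover_def)
  have "ind F I" unfolding ind_def
  proof (rule compact_shatters[OF K])
    show "closed ((T ^^ i) -` F)" "closed ((T ^^ i) -` (- u F))" for i
      using cl contn by (auto intro: closed_vimage simp del: vimage_Compl)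
  qed (use I(2) in \<open>auto simp: ind_def\<close>)
  then show False using tame_not_shatters_infinite[OF K tame cl I(1)] by (simp add: ind_def)
qed

lemma tame_cover_entropy_zero:
  fixes T :: "'a::t2_space \<Rightarrow> 'a"
  assumes K: "compact (UNIV :: 'a set)" and T: "continuous_on UNIV T" and tame: "tame T"
    and \<U>: "finite_open_cover \<U>"
  shows "cover_entropy T \<U> = 0"
proof -
  define N where "N n = real (min_subcover_card (iterated_join T \<U> n))" for n
  have "0 < min_subcover_card (iterated_join T \<U> n)" for n
    using finite_cover_iterated_join[of \<U> T n] \<U> unfolding finite_open_cover_def
    by (intro min_subcover_card_pos) auto
  then have N: "1 \<le> N n" for n by (simp add: N_def Suc_le_eq)
  have "(\<lambda>n. ln (N n) / real n) \<longlonglongrightarrow> 0"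
  proof (rule tendstoI)
    fix e :: real assume e: "0 < e"
    have "\<forall>\<^sub>F n in sequentially. N n \<le> exp (e / 2 * n)"
      using tame_join_growth[OF K T tame \<U>, of "e / 2"] e by (simp add: N_def)
    then show "\<forall>\<^sub>F n in sequentially. dist (ln (N n) / real n) 0 < e"
      using eventually_gt_at_top[of 0]
    proof eventually_elim
      case (elim n)
      have "ln (N n) \<le> ln (exp (e / 2 * n))"
        using elim(1) N[of n] by (intro ln_mono) auto
      then have "ln (N n) \<le> e / 2 * n" by simp
      also have "\<dots> < e * n" using elim(2) e by simp
      finally have "ln (N n) / n < e" using elim(2) by (simp add: divide_less_eq)
      moreover have "0 \<le> ln (N n) / n" using N[of n] by simp
      ultimately show ?case by (simp add: dist_real_def)
    qed
  qed
  then show ?thesis unfolding cover_entropy_def N_def by (rule limI)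
qed

theorem corollary5p6:
  fixes T :: "'a::t2_space \<Rightarrow> 'a"
  assumes "compact (UNIV :: 'a set)"
    and "homeomorphism UNIV UNIV T (inv T)"
    and "tame T"
  shows "topological_entropy T = 0"
proof -
  have T: "continuous_on UNIV T" using assms(2) by (simp add: homeomorphism_def)
  have "finite_open_cover {UNIV :: 'a set}" by (simp add: finite_open_cover_def)
  then have "{\<U> :: 'a set set. finite_open_cover \<U>} \<noteq> {}" by blast
  moreover have "ereal (cover_entropy T \<U>) = 0" if "\<U> \<in> {\<U>. finite_open_cover \<U>}" for \<U>
    using tame_cover_entropy_zero[OF assms(1) T assms(3), of \<U>] that by simp
  ultimately show ?thesis unfolding topological_entropy_def by (rule SUP_eq_const)
qed

end
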